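(* Let $\sigma\in\mathbb R$, let $V:\mathbb R\to\mathbb R$ be smooth, and let $\hat u(z,k)$ be a family of functions, $2\pi$-periodic in $z$ and depending smoothly on $(z,k)$ for $k$ in an open interval, such that $k^4\hat u_{zzzz}+\sigma k^2\hat u_{zz}+V'(\hat u)=0$ for each $k$. Let $$\overline L(k)=\frac1{2\pi}\int_0^{2\pi}\Big(k^4\hat u_z\hat u_{zzz}+\tfrac12k^4\hat u_{zz}^2+\tfrac12\sigma k^2\hat u_z^2-V(\hat u)\Big)\,dz$$ be the averaged Lagrangian and $$A(k)=\frac1{2\pi}\int_0^{2\pi}\big(\sigma k\,\hat u_z^2-2k^3\hat u_{zz}^2\big)\,dz$$ the action of the family. Then $$A(k)=\frac{d}{dk}\overline L(k).$$
   Context: The functions $u(x)=\hat u(kx,k)$ are periodic solutions, of wavenumber $k$, of $u_{xxxx}+\sigma u_{xx}+V'(u)=0$, whose Lagrangian density is $u_xu_{xxx}+\tfrac12u_{xx}^2+\tfrac12\sigma u_x^2-V(u)$. *)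

theory Defs
  imports "HOL-Analysis.Analysis"
begin

text \<open>
  \<open>C_on n S f\<close>: all partial derivatives of \<open>f\<close> of order at most \<open>n\<close> exist and are continuous on
  the open set \<open>S\<close>. The iterated derivatives are taken in all constant directions \<open>v\<close>; since the
  domain is finite-dimensional, this is the usual class \<open>C^n\<close>.
\<close>

primrec C_on :: "nat \<Rightarrow> 'a::euclidean_space set \<Rightarrow> ('a \<Rightarrow> real) \<Rightarrow> bool" where
  "C_on 0 S f \<longleftrightarrow> continuous_on S f"
| "C_on (Suc n) S f \<longleftrightarrow>
     (\<forall>x\<in>S. f differentiable (at x)) \<and> (\<forall>v. C_on n S (\<lambda>x. frechet_derivative f (at x) v))"

definition smooth_on :: "'a::euclidean_space set \<Rightarrow> ('a \<Rightarrow> real) \<Rightarrow> bool" where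
  "smooth_on S f \<longleftrightarrow> open S \<and> (\<forall>n. C_on n S f)"

definition dz :: "nat \<Rightarrow> (real \<Rightarrow> real \<Rightarrow> real) \<Rightarrow> real \<Rightarrow> real \<Rightarrow> real" where
  "dz n u z k = (deriv ^^ n) (\<lambda>s. u s k) z"

definition avg_lagrangian ::
    "real \<Rightarrow> (real \<Rightarrow> real) \<Rightarrow> (real \<Rightarrow> real \<Rightarrow> real) \<Rightarrow> real \<Rightarrow> real" where
  "avg_lagrangian \<sigma> V u k =
     1 / (2 * pi) * integral {0..2 * pi} (\<lambda>z.
       k ^ 4 * dz 1 u z k * dz 3 u z k + 1 / 2 * k ^ 4 * (dz 2 u z k)\<^sup>2
       + 1 / 2 * \<sigma> * k\<^sup>2 * (dz 1 u z k)\<^sup>2 - V (u z k))"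

definition wave_action :: "real \<Rightarrow> (real \<Rightarrow> real \<Rightarrow> real) \<Rightarrow> real \<Rightarrow> real" where
  "wave_action \<sigma> u k =
     1 / (2 * pi) * integral {0..2 * pi} (\<lambda>z.
       \<sigma> * k * (dz 1 u z k)\<^sup>2 - 2 * k ^ 3 * (dz 2 u z k)\<^sup>2)"

end

theory Submission
  imports Defs
begin

text \<open>
  The averaged Lagrangian is a functional of the periodic profile \<open>u(\<cdot>, k)\<close> that also contains \<open>k\<close>
  explicitly, and the ordinary differential equation says that the profile is a critical point of it
  at fixed \<open>k\<close>. So only the explicit \<open>k\<close>-dependence contributes to the derivative.

  Since \<open>u\<^sub>z u\<^sub>z\<^sub>z\<^sub>z = (u\<^sub>z u\<^sub>z\<^sub>z)\<^sub>z - u\<^sub>z\<^sub>z\<^sup>2\<close>, the Lagrangian density has the same average as the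
  reduced density \<open>R = - k\<^sup>4 u\<^sub>z\<^sub>z\<^sup>2 / 2 + \<sigma> k\<^sup>2 u\<^sub>z\<^sup>2 / 2 - V(u)\<close>, whose explicit \<open>k\<close>-derivative is
  exactly the action density. With \<open>w = \<partial>u/\<partial>k\<close>, the remaining part of \<open>\<partial>R/\<partial>k\<close> is
  \<open>- k\<^sup>4 u\<^sub>z\<^sub>z w\<^sub>z\<^sub>z + \<sigma> k\<^sup>2 u\<^sub>z w\<^sub>z - V'(u) w\<close>; after eliminating \<open>V'(u)\<close> by the equation it becomes the
  \<open>z\<close>-derivative of the periodic function
  \<open>k\<^sup>4 (u\<^sub>z\<^sub>z\<^sub>z w - u\<^sub>z\<^sub>z w\<^sub>z) + \<sigma> k\<^sup>2 u\<^sub>z w\<close> and so integrates to zero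
  (\<open>integral_deriv_periodic_eq_0\<close>). This computation exchanges \<open>\<partial>/\<partial>k\<close> with the integral, by the Leibniz
  rule, and with \<open>\<partial>/\<partial>z\<close>, by \<open>mixed_partials_commute\<close>.
\<close>

section \<open>Partial derivatives of smooth functions\<close>

definition dir_deriv :: "'a::euclidean_space \<Rightarrow> ('a \<Rightarrow> real) \<Rightarrow> 'a \<Rightarrow> real" where
  "dir_deriv v f x = frechet_derivative f (at x) v"

lemma smooth_on_dir_deriv:
  assumes "smooth_on S f"
  shows "smooth_on S (dir_deriv v f)"
proof -
  have "C_on (Suc n) S f" for n
    using assms by (simp add: smooth_on_def)
  then show ?thesis
    using assms by (simp add: smooth_on_def dir_deriv_def [abs_def])
qed

lemma smooth_on_dir_deriv_funpow:
  "smooth_on S f \<Longrightarrow> smooth_on S ((dir_deriv v ^^ n) f)"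
  by (induction n) (auto intro: smooth_on_dir_deriv)

lemma smooth_on_imp_continuous_on:
  assumes "smooth_on S f"
  shows "continuous_on S f"
proof -
  have "C_on 0 S f"
    using assms unfolding smooth_on_def by blast
  then show ?thesis by simp
qed

lemma smooth_on_imp_has_derivative:
  assumes "smooth_on S f" "x \<in> S"
  shows "(f has_derivative (\<lambda>v. dir_deriv v f x)) (at x)"
proof -
  have "C_on (Suc 0) S f"
    using assms unfolding smooth_on_def by blast
  then have "f differentiable at x"
    using assms(2) by simp
  then show ?thesis
    unfolding dir_deriv_def by (simp add: frechet_derivative_works)
qed

text \<open>
  Partial derivatives on the plane and ordinary derivatives on the line are both instances of the
  chain rule along a line with velocity \<open>v\<close>.
\<close>

lemma dir_deriv_along_curve:
  assumes "smooth_on S f" "c t \<in> S" "(c has_derivative (\<lambda>r. r *\<^sub>R v)) (at t)"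
  shows "((\<lambda>r. f (c r)) has_real_derivative dir_deriv v f (c t)) (at t)"
proof -
  have f': "(f has_derivative (\<lambda>v. dir_deriv v f (c t))) (at (c t))"
    using smooth_on_imp_has_derivative [OF assms(1,2)] .
  have "linear (\<lambda>v. dir_deriv v f (c t))"
    using f' by (rule has_derivative_linear)
  then have "dir_deriv (r *\<^sub>R v) f (c t) = dir_deriv v f (c t) * r" for r
    by (simp add: linear_scale [where f = "\<lambda>v. dir_deriv v f (c t)"])
  with has_derivative_compose [OF assms(3) f'] show ?thesis
    by (simp add: has_field_derivative_def)
qed

lemma smooth_on_partial_fst:
  assumes "smooth_on S f" "(z, k) \<in> S"
  shows "((\<lambda>s. f (s, k)) has_real_derivative dir_deriv (1, 0) f (z, k)) (at z)"
  using assms by (rule dir_deriv_along_curve) (auto intro!: derivative_eq_intros)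

lemma smooth_on_partial_snd:
  assumes "smooth_on S f" "(z, k) \<in> S"
  shows "((\<lambda>l. f (z, l)) has_real_derivative dir_deriv (0, 1) f (z, k)) (at k)"
  using assms by (rule dir_deriv_along_curve) (auto intro!: derivative_eq_intros)

text \<open>
  Write \<open>f(s, l) - f(a, l)\<close> as the integral of \<open>p = f\<^sub>z\<close> over \<open>[a, s]\<close>. Differentiating under the integral
  gives \<open>f\<^sub>k(s, k) - f\<^sub>k(a, k)\<close> as the integral of \<open>f\<^sub>z\<^sub>k\<close>, and the fundamental theorem of calculus
  then yields \<open>f\<^sub>k\<^sub>z = f\<^sub>z\<^sub>k\<close>.
\<close>

lemma mixed_partials_commute:
  fixes f p g q :: "real \<Rightarrow> real \<Rightarrow> real"
  assumes K: "open K" "convex K" "k \<in> K"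
    and f_z: "\<And>z k. k \<in> K \<Longrightarrow> ((\<lambda>s. f s k) has_real_derivative p z k) (at z)"
    and f_k: "\<And>z k. k \<in> K \<Longrightarrow> ((\<lambda>l. f z l) has_real_derivative g z k) (at k)"
    and p_k: "\<And>z k. k \<in> K \<Longrightarrow> ((\<lambda>l. p z l) has_real_derivative q z k) (at k)"
    and q_cont: "continuous_on (UNIV \<times> K) (\<lambda>(z, k). q z k)"
  shows "((\<lambda>s. g s k) has_real_derivative q z k) (at z)"
proof -
  \<comment> \<open>Any base point to the left of \<open>z\<close> serves.\<close>
  define a where "a = z - 1"
  have f_int: "((\<lambda>t. p t l) has_integral (f s l - f a l)) {a..s}" if "l \<in> K" "a \<le> s" for s l
    using that f_z [OF \<open>l \<in> K\<close>]
    by (intro fundamental_theorem_of_calculus)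
       (auto simp: has_real_derivative_iff_has_vector_derivative [symmetric]
             intro: has_field_derivative_at_within)
  have g_int: "g s k = g a k + integral {a..s} (\<lambda>t. q t k)" if "a \<le> s" for s
  proof -
    have "((\<lambda>l. integral (cbox a s) (\<lambda>t. p t l)) has_real_derivative
             integral (cbox a s) (\<lambda>t. q t k)) (at k within K)"
    proof (rule leibniz_rule_field_derivative [where f = "\<lambda>l t. p t l" and fx = "\<lambda>l t. q t l"])
      have "continuous_on (K \<times> cbox a s) (\<lambda>x. (\<lambda>(z, k). q z k) (snd x, fst x))"
        by (rule continuous_on_compose2 [OF q_cont]) (auto intro!: continuous_intros)
      then show "continuous_on (K \<times> cbox a s) (\<lambda>(l, t). q t l)"
        by (simp add: case_prod_unfold)
    qed (use K f_int [OF _ that] in \<open>auto intro: has_field_derivative_at_within p_k\<close>)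
    then have "((\<lambda>l. integral {a..s} (\<lambda>t. p t l)) has_real_derivative
             integral {a..s} (\<lambda>t. q t k)) (at k)"
      by (simp add: at_within_open [OF K(3,1)])
    moreover have "((\<lambda>l. integral {a..s} (\<lambda>t. p t l)) has_real_derivative g s k - g a k) (at k)"
      by (rule has_field_derivative_transform_within_open
            [where f = "\<lambda>l. f s l - f a l" and S = K])
         (use K in \<open>auto intro!: derivative_eq_intros f_k
                    simp: integral_unique [OF f_int [OF _ that]]\<close>)
    ultimately show ?thesis
      using DERIV_unique by fastforce
  qed
  have q_slice: "continuous_on {a..z + 1} (\<lambda>t. q t k)"
  proof -
    have "continuous_on {a..z + 1} (\<lambda>t. (\<lambda>(z, k). q z k) (t, k))"
      by (rule continuous_on_compose2 [OF q_cont]) (use K in \<open>auto intro!: continuous_intros\<close>)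
    then show ?thesis by simp
  qed
  have "((\<lambda>s. integral {a..s} (\<lambda>t. q t k)) has_real_derivative q z k) (at z within {a..z + 1})"
    by (rule integral_has_real_derivative [OF q_slice]) (simp add: a_def)
  then have "((\<lambda>s. integral {a..s} (\<lambda>t. q t k)) has_real_derivative q z k) (at z)"
    by (simp add: a_def at_within_Icc_at)
  then have "((\<lambda>s. g a k + integral {a..s} (\<lambda>t. q t k)) has_real_derivative q z k) (at z)"
    by (auto intro!: derivative_eq_intros)
  then show ?thesis
    by (rule has_field_derivative_transform_within_open [where S = "{a<..}"])
       (auto simp: a_def g_int [symmetric, unfolded a_def])
qed

section \<open>Periodic functions\<close>

lemma integral_deriv_periodic_eq_0:
  fixes G G' :: "real \<Rightarrow> real"
  assumes "\<And>z. (G has_real_derivative G' z) (at z)" "0 \<le> T" "G T = G 0"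
  shows "(G' has_integral 0) {0..T}"
proof -
  have "(G' has_integral (G T - G 0)) {0..T}"
    using assms
    by (intro fundamental_theorem_of_calculus)
       (auto simp: has_real_derivative_iff_has_vector_derivative [symmetric]
             intro: has_field_derivative_at_within)
  then show ?thesis using assms by simp
qed

lemma deriv_funpow_periodic:
  fixes f :: "real \<Rightarrow> real"
  assumes "\<And>z. f (z + T) = f z"
  shows "(deriv ^^ n) f (z + T) = (deriv ^^ n) f z"
proof (induction n arbitrary: z)
  case (Suc n)
  then show ?case
    by (simp add: deriv_def DERIV_shift)
qed (use assms in simp)

section \<open>The action as derivative of the averaged Lagrangian\<close>

theorem mainTheorem4:
  fixes \<sigma> :: real and V :: "real \<Rightarrow> real"
    and u :: "real \<Rightarrow> real \<Rightarrow> real" and K :: "real set"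
  assumes "smooth_on UNIV V"
    and "open K" and "is_interval K"
    and "smooth_on (UNIV \<times> K) (\<lambda>(z, k). u z k)"
    and "\<And>z k. k \<in> K \<Longrightarrow> u (z + 2 * pi) k = u z k"
    and "\<And>z k. k \<in> K \<Longrightarrow>
           k ^ 4 * dz 4 u z k + \<sigma> * k\<^sup>2 * dz 2 u z k + deriv V (u z k) = 0"
  shows "\<forall>k\<in>K. (avg_lagrangian \<sigma> V u has_real_derivative wave_action \<sigma> u k) (at k)"
proof
  fix k assume k: "k \<in> K"
  note V_smooth = assms(1) and K_open = assms(2) and u_smooth = assms(4)
    and periodic = assms(5) and ode = assms(6)
  have K_convex: "convex K"
    using assms(3) by (simp add: is_interval_convex_1)

  \<comment> \<open>\<open>U n\<close> is the \<open>n\<close>-th \<open>z\<close>-derivative of \<open>u\<close>, and \<open>W n\<close> the \<open>k\<close>-derivative of \<open>U n\<close>.\<close>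
  define P where "P n = (dir_deriv (1, 0) ^^ n) (\<lambda>(z, k). u z k)" for n
  define U where "U n z k = P n (z, k)" for n z k
  define W where "W n z k = dir_deriv (0, 1) (P n) (z, k)" for n z k

  have P_smooth: "smooth_on (UNIV \<times> K) (P n)" for n
    unfolding P_def by (rule smooth_on_dir_deriv_funpow [OF u_smooth])
  have U_z: "((\<lambda>s. U n s l) has_real_derivative U (Suc n) z l) (at z)" if "l \<in> K" for n z l
    using smooth_on_partial_fst [OF P_smooth, of z l n] that by (simp add: U_def P_def)
  have U_k: "((\<lambda>l. U n z l) has_real_derivative W n z l) (at l)" if "l \<in> K" for n z l
    using smooth_on_partial_snd [OF P_smooth, of z l n] that by (simp add: U_def W_def)
  have U_cont: "continuous_on (UNIV \<times> K) (\<lambda>(z, k). U n z k)" for n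
    using smooth_on_imp_continuous_on [OF P_smooth] by (simp add: U_def case_prod_unfold)
  have W_cont: "continuous_on (UNIV \<times> K) (\<lambda>(z, k). W n z k)" for n
    using smooth_on_imp_continuous_on [OF smooth_on_dir_deriv [OF P_smooth]]
    by (simp add: W_def case_prod_unfold)
  have W_z: "((\<lambda>s. W n s l) has_real_derivative W (Suc n) z l) (at z)" if "l \<in> K" for n z l
    by (rule mixed_partials_commute [OF K_open K_convex that U_z U_k U_k W_cont])

  have u_eq: "u z l = U 0 z l" for z l
    by (simp add: U_def P_def)
  have dz_eq: "dz n u z l = U n z l" if "l \<in> K" for n z l
  proof -
    have "(deriv ^^ n) (\<lambda>s. u s l) = (\<lambda>s. U n s l)"
    proof (induction n)
      case (Suc n)
      show ?case
        by (simp add: Suc.IH) (intro ext DERIV_imp_deriv U_z that)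
    qed (simp add: u_eq)
    then show ?thesis by (simp add: dz_def)
  qed
  have U_periodic: "U n (2 * pi) l = U n 0 l" if "l \<in> K" for n l
    using deriv_funpow_periodic [of "\<lambda>s. u s l" "2 * pi" n 0] periodic that
    by (simp add: dz_def flip: dz_eq)
  \<comment> \<open>Periodicity holds for all wavenumbers near \<open>k\<close>, so it can be differentiated in \<open>k\<close>.\<close>
  have W_periodic: "W n (2 * pi) k = W n 0 k" for n
  proof (rule DERIV_unique)
    show "((\<lambda>l. U n (2 * pi) l) has_real_derivative W n (2 * pi) k) (at k)"
      using k by (rule U_k)
    show "((\<lambda>l. U n (2 * pi) l) has_real_derivative W n 0 k) (at k)"
      by (rule has_field_derivative_transform_within_open [OF U_k [OF k, of n 0] K_open k])
         (simp add: U_periodic)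
  qed

  have V_deriv: "(V has_real_derivative deriv V x) (at x)" for x
  proof -
    have "(V has_real_derivative dir_deriv 1 V x) (at x)"
      using dir_deriv_along_curve [OF V_smooth, of "\<lambda>r. r" x 1] by simp
    then show ?thesis by (simp add: DERIV_imp_deriv)
  qed
  have V_cont: "continuous_on UNIV V"
    by (rule smooth_on_imp_continuous_on [OF V_smooth])
  have V'_cont: "continuous_on UNIV (deriv V)"
  proof -
    have "dir_deriv 1 V x = deriv V x" for x
      using dir_deriv_along_curve [OF V_smooth, of "\<lambda>r. r" x 1]
      by (simp add: DERIV_imp_deriv)
    then show ?thesis
      using smooth_on_imp_continuous_on [OF smooth_on_dir_deriv [OF V_smooth, of 1]]
      by (simp add: fun_eq_iff cong: continuous_on_cong)
  qed

  \<comment> \<open>The reduced density and its \<open>k\<close>-derivative.\<close>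
  define R where "R l z = - 1 / 2 * l ^ 4 * (U 2 z l)\<^sup>2 + 1 / 2 * \<sigma> * l\<^sup>2 * (U 1 z l)\<^sup>2
      - V (U 0 z l)" for l z
  define R' where "R' l z = - 2 * l ^ 3 * (U 2 z l)\<^sup>2 - l ^ 4 * U 2 z l * W 2 z l
      + \<sigma> * l * (U 1 z l)\<^sup>2 + \<sigma> * l\<^sup>2 * U 1 z l * W 1 z l - deriv V (U 0 z l) * W 0 z l" for l z

  have [continuous_intros]: "continuous_on B (\<lambda>z. U n z l)" if "l \<in> K" for n l B
    by (rule DERIV_continuous_on) (rule has_field_derivative_at_within [OF U_z [OF that]])
  have swap: "continuous_on (K \<times> B) (\<lambda>x. h (snd x) (fst x))"
    if "continuous_on (UNIV \<times> K) (\<lambda>(z, k). h z k)" for h :: "real \<Rightarrow> real \<Rightarrow> real" and B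
  proof -
    have "continuous_on (K \<times> B) (\<lambda>x. (\<lambda>(z, k). h z k) (snd x, fst x))"
      by (rule continuous_on_compose2 [OF that]) (auto intro!: continuous_intros)
    then show ?thesis by simp
  qed
  note [continuous_intros] = swap [OF U_cont] swap [OF W_cont]
  note [continuous_intros] = continuous_on_compose2 [OF V_cont] continuous_on_compose2 [OF V'_cont]

  have avg_eq: "avg_lagrangian \<sigma> V u l = 1 / (2 * pi) * integral {0..2 * pi} (R l)"
    if l: "l \<in> K" for l
  proof -
    have "((\<lambda>z. l ^ 4 * (U 2 z l * U 2 z l + U 1 z l * U 3 z l)) has_integral 0) {0..2 * pi}"
    proof (rule integral_deriv_periodic_eq_0 [where G = "\<lambda>z. l ^ 4 * (U 1 z l * U 2 z l)"])
      show "((\<lambda>z. l ^ 4 * (U 1 z l * U 2 z l)) has_real_derivative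
          l ^ 4 * (U 2 z l * U 2 z l + U 1 z l * U 3 z l)) (at z)" for z
        using U_z [OF l, of 1 z] U_z [OF l, of 2 z]
        by (auto intro!: derivative_eq_intros simp: numeral_2_eq_2 numeral_3_eq_3 algebra_simps)
    qed (simp_all add: U_periodic [OF l])
    moreover have "R l integrable_on {0..2 * pi}"
      unfolding R_def
      by (intro integrable_continuous_real continuous_intros) (use l in auto)
    ultimately have "((\<lambda>z. l ^ 4 * (U 2 z l * U 2 z l + U 1 z l * U 3 z l) + R l z)
        has_integral 0 + integral {0..2 * pi} (R l)) {0..2 * pi}"
      by (intro has_integral_add integrable_integral)
    moreover have "(\<lambda>z. l ^ 4 * (U 2 z l * U 2 z l + U 1 z l * U 3 z l) + R l z) =
       (\<lambda>z. l ^ 4 * dz 1 u z l * dz 3 u z l + 1 / 2 * l ^ 4 * (dz 2 u z l)\<^sup>2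
       + 1 / 2 * \<sigma> * l\<^sup>2 * (dz 1 u z l)\<^sup>2 - V (u z l))"
      by (auto simp: dz_eq [OF l] u_eq R_def algebra_simps power2_eq_square)
    ultimately show ?thesis
      by (simp add: avg_lagrangian_def integral_unique)
  qed

  have R_deriv: "((\<lambda>l. R l z) has_real_derivative R' l z) (at l)" if "l \<in> K" for l z
    unfolding R_def R'_def
    using that
    by (auto intro!: derivative_eq_intros U_k DERIV_chain2 [OF V_deriv]
             simp: field_simps power2_eq_square)
  have "((\<lambda>l. integral (cbox 0 (2 * pi)) (R l)) has_real_derivative
      integral (cbox 0 (2 * pi)) (R' k)) (at k within K)"
  proof (rule leibniz_rule_field_derivative [where f = R and fx = R', OF _ _ _ k K_convex])
    show "continuous_on (K \<times> cbox 0 (2 * pi)) (\<lambda>(l, z). R' l z)"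
      unfolding R'_def case_prod_unfold by (intro continuous_intros) auto
    show "R l integrable_on cbox 0 (2 * pi)" if "l \<in> K" for l
      unfolding R_def
      by (intro integrable_continuous continuous_intros) (use that in auto)
  qed (simp add: has_field_derivative_at_within R_deriv)
  then have "((\<lambda>l. 1 / (2 * pi) * integral {0..2 * pi} (R l)) has_real_derivative
      1 / (2 * pi) * integral {0..2 * pi} (R' k)) (at k)"
    by (intro DERIV_cmult) (simp add: at_within_open [OF k K_open])
  then have avg_deriv: "(avg_lagrangian \<sigma> V u has_real_derivative
      1 / (2 * pi) * integral {0..2 * pi} (R' k)) (at k)"
    by (rule has_field_derivative_transform_within_open [OF _ K_open k]) (simp only: avg_eq)

  define A where "A z = \<sigma> * k * (U 1 z k)\<^sup>2 - 2 * k ^ 3 * (U 2 z k)\<^sup>2" for z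
  \<comment> \<open>\<open>G\<close> collects the boundary terms of the integrations by parts that move all \<open>z\<close>-derivatives
     off \<open>W 0\<close>.\<close>
  define G where "G z = k ^ 4 * (U 3 z k * W 0 z k - U 2 z k * W 1 z k)
      + \<sigma> * k\<^sup>2 * (U 1 z k * W 0 z k)" for z
  have "((\<lambda>z. R' k z - A z) has_integral 0) {0..2 * pi}"
  proof (rule integral_deriv_periodic_eq_0 [where G = G])
    fix z
    have V': "deriv V (U 0 z k) = - (k ^ 4 * U 4 z k) - \<sigma> * k\<^sup>2 * U 2 z k"
      using ode [OF k, of z] by (simp add: dz_eq [OF k] u_eq)
    have "(G has_real_derivative
        k ^ 4 * (U 4 z k * W 0 z k - U 2 z k * W 2 z k)
        + \<sigma> * k\<^sup>2 * (U 2 z k * W 0 z k + U 1 z k * W 1 z k)) (at z)"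
      unfolding G_def
      using U_z [OF k, of 1 z] U_z [OF k, of 2 z] U_z [OF k, of 3 z]
        W_z [OF k, of 0 z] W_z [OF k, of 1 z]
      by (auto intro!: derivative_eq_intros
               simp: numeral_2_eq_2 numeral_3_eq_3 eval_nat_numeral algebra_simps)
    then show "(G has_real_derivative R' k z - A z) (at z)"
      by (simp add: R'_def A_def V' algebra_simps)
  qed (simp_all add: G_def U_periodic [OF k] W_periodic)
  moreover have "A integrable_on {0..2 * pi}"
    unfolding A_def
    by (intro integrable_continuous_real continuous_intros) (use k in auto)
  ultimately have "((\<lambda>z. R' k z - A z + A z) has_integral 0 + integral {0..2 * pi} A) {0..2 * pi}"
    by (intro has_integral_add integrable_integral)
  then have "integral {0..2 * pi} (R' k) = integral {0..2 * pi} A"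
    by (simp add: integral_unique)
  then have "1 / (2 * pi) * integral {0..2 * pi} (R' k) = wave_action \<sigma> u k"
    by (simp add: wave_action_def A_def [abs_def] dz_eq [OF k])
  with avg_deriv show "(avg_lagrangian \<sigma> V u has_real_derivative wave_action \<sigma> u k) (at k)"
    by simp
qed

end
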